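(* Let $(R_1,f_1,g_1)$ and $(R_2,f_2,g_2)$ be commutative Krasner $(m,n)$-hyperrings with scalar identities, let $S$ be an $n$-ary multiplicative subset of $R_1$, and let $h:R_1\to R_2$ be a homomorphism such that $0\notin h(S)$. If $I_2$ is an $n$-ary $h(S)$-prime hyperideal of $R_2$, then $h^{-1}(I_2)$ is an $n$-ary $S$-prime hyperideal of $R_1$.
   Context: Notation: $x_i^j$ denotes the sequence $x_i,\dots,x_j$ (empty if $j<i$); $x^{(k)}$ denotes $x$ repeated $k$ times; operations are extended to subsets elementwise (taking unions); $m,n\ge 2$ are integers. An $m$-ary hyperoperation on $R$ is a map $f$ from $R^m$ to the nonempty subsets of $R$. $(R,f)$ is a (commutative) canonical $m$-ary hypergroup if $f$ is invariant under permuting its arguments; $f$ is associative, i.e. $f(x_1^{i-1},f(x_i^{m+i-1}),x_{m+i}^{2m-1})$ does not depend on $i$; for all $a_1^{i-1},a_{i+1}^m,b\in R$ there is $x\in R$ with $b\in f(a_1^{i-1},x,a_{i+1}^m)$; there is a unique $0\in R$ with $f(x,0^{(m-1)})=\{x\}$ for all $x$; each $x$ has a unique $-x$ with $0\in f(x,-x,0^{(m-2)})$; and $x\in f(x_1^m)$ implies $x_i\in f(x,-x_1,\dots,-x_{i-1},-x_{i+1},\dots,-x_m)$ for all $i$. A commutative Krasner $(m,n)$-hyperring $(R,f,g)$ is such an $(R,f)$ together with an associative, permutation-invariant $n$-ary operation $g:R^n\to R$ that is distributive over $f$ in each argument, i.e. $g(a_1^{i-1},f(x_1^m),a_{i+1}^n)=f(g(a_1^{i-1},x_1,a_{i+1}^n),\dots,g(a_1^{i-1},x_m,a_{i+1}^n))$,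 and satisfies $g(0,x_2^n)=0$. A scalar identity is an element $1$ with $g(x,1^{(n-1)})=x$ for all $x$. A homomorphism $h:R_1\to R_2$ is a map with $h(f_1(x_1,\dots,x_m))=f_2(h(x_1),\dots,h(x_m))$ and $h(g_1(y_1,\dots,y_n))=g_2(h(y_1),\dots,h(y_n))$ for all $x_1^m,y_1^n\in R_1$. A hyperideal of $R$ is a nonempty $I\subseteq R$ such that $(I,f)$ is an $m$-ary subhypergroup of $(R,f)$ (i.e. $f(x_1^m)\subseteq I$ for $x_1^m\in I$, and $b\in f(b_1^{i-1},x,b_{i+1}^m)$ has a solution $x\in I$ whenever all $b$'s lie in $I$) and $g(x_1^{i-1},I,x_{i+1}^n)\subseteq I$ for all $x_j\in R$ and all $i$. An $n$-ary multiplicative subset is a nonempty $S\subseteq R$ with $g(s_1^n)\in S$ for all $s_1^n\in S$. A hyperideal $I$ with $I\cap S=\varnothing$ is an $n$-ary $S$-prime hyperideal if there exists $s\in S$ such that for all $x_1^n\in R$ with $g(x_1^n)\in I$ one has $g(s,x_i,1^{(n-2)})\in I$ for some $1\le i\le n$.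
   Formalization: The homomorphism h is additionally assumed to satisfy h(0)=0; without this the claim fails, e.g. for the constant map 1 on the hyperfield of signs with S={1} and I_2={0}, where h^{-1}(I_2) is empty. *)

theory Defs
  imports "HOL-Library.NList" "HOL-Library.Multiset" "HOL-Library.FuncSet"
begin

text \<open>
  An \<open>n\<close>-ary (hyper)operation on a carrier \<open>R\<close> is a function on lists, constrained only on
  \<open>nlists n R\<close>, the lists of length \<open>n\<close> with entries in \<open>R\<close>. An argument position \<open>i\<close> is
  expressed by a splitting \<open>as @ x # bs\<close>, and indices start at \<open>0\<close>.
\<close>

definition is_zero :: "nat \<Rightarrow> 'a set \<Rightarrow> ('a list \<Rightarrow> 'a set) \<Rightarrow> 'a \<Rightarrow> bool" where
  "is_zero m R f z \<longleftrightarrow> z \<in> R \<and> (\<forall>x\<in>R. f (x # replicate (m - 1) z) = {x})"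

text \<open>The definite descriptions below are justified by the uniqueness axioms in the locale
  \<open>canonical_hypergroup\<close>.\<close>

definition hzero :: "nat \<Rightarrow> 'a set \<Rightarrow> ('a list \<Rightarrow> 'a set) \<Rightarrow> 'a" where
  "hzero m R f = (THE z. is_zero m R f z)"

definition is_neg :: "nat \<Rightarrow> 'a set \<Rightarrow> ('a list \<Rightarrow> 'a set) \<Rightarrow> 'a \<Rightarrow> 'a \<Rightarrow> bool" where
  "is_neg m R f x y \<longleftrightarrow>
     y \<in> R \<and> hzero m R f \<in> f (x # y # replicate (m - 2) (hzero m R f))"

definition hneg :: "nat \<Rightarrow> 'a set \<Rightarrow> ('a list \<Rightarrow> 'a set) \<Rightarrow> 'a \<Rightarrow> 'a" where
  "hneg m R f x = (THE y. is_neg m R f x y)"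

text \<open>In \<open>assoc\<close>, the union is the elementwise extension of \<open>f\<close> to the subset
  \<open>f(x\<^sub>i, \<dots>, x\<^sub>i\<^sub>+\<^sub>m\<^sub>-\<^sub>1)\<close> in one argument position.\<close>

locale canonical_hypergroup =
  fixes m :: nat and R :: "'a set" and f :: "'a list \<Rightarrow> 'a set"
  assumes arity: "2 \<le> m"
    and closed: "xs \<in> nlists m R \<Longrightarrow> f xs \<subseteq> R"
    and nonempty: "xs \<in> nlists m R \<Longrightarrow> f xs \<noteq> {}"
    and perm: "xs \<in> nlists m R \<Longrightarrow> ys \<in> nlists m R \<Longrightarrow> mset xs = mset ys \<Longrightarrow> f xs = f ys"
    and assoc: "xs \<in> nlists (2 * m - 1) R \<Longrightarrow> i < m \<Longrightarrow> j < m \<Longrightarrow>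
      (\<Union>y\<in>f (take m (drop i xs)). f (take i xs @ y # drop (i + m) xs)) =
      (\<Union>y\<in>f (take m (drop j xs)). f (take j xs @ y # drop (j + m) xs))"
    and solvable: "as @ bs \<in> nlists (m - 1) R \<Longrightarrow> b \<in> R \<Longrightarrow> \<exists>x\<in>R. b \<in> f (as @ x # bs)"
    and zero_unique: "\<exists>!z. is_zero m R f z"
    and neg_unique: "x \<in> R \<Longrightarrow> \<exists>!y. is_neg m R f x y"
    and reversible: "xs \<in> nlists m R \<Longrightarrow> x \<in> f xs \<Longrightarrow> i < m \<Longrightarrow>
      xs ! i \<in> f (x # map (hneg m R f) (take i xs) @ map (hneg m R f) (drop (Suc i) xs))"

locale comm_krasner_hyperring = canonical_hypergroup m R f
  for m :: nat and n :: nat and R :: "'a set" and f :: "'a list \<Rightarrow> 'a set"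
    and g :: "'a list \<Rightarrow> 'a" +
  assumes mult_arity: "2 \<le> n"
    and mult_closed: "xs \<in> nlists n R \<Longrightarrow> g xs \<in> R"
    and mult_perm: "xs \<in> nlists n R \<Longrightarrow> ys \<in> nlists n R \<Longrightarrow> mset xs = mset ys \<Longrightarrow> g xs = g ys"
    and mult_assoc: "xs \<in> nlists (2 * n - 1) R \<Longrightarrow> i < n \<Longrightarrow> j < n \<Longrightarrow>
      g (take i xs @ g (take n (drop i xs)) # drop (i + n) xs) =
      g (take j xs @ g (take n (drop j xs)) # drop (j + n) xs)"
    and distrib: "as @ bs \<in> nlists (n - 1) R \<Longrightarrow> xs \<in> nlists m R \<Longrightarrow>
      (\<lambda>x. g (as @ x # bs)) ` f xs = f (map (\<lambda>x. g (as @ x # bs)) xs)"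
    and mult_zero: "xs \<in> nlists (n - 1) R \<Longrightarrow> g (hzero m R f # xs) = hzero m R f"

definition scalar_identity :: "nat \<Rightarrow> 'a set \<Rightarrow> ('a list \<Rightarrow> 'a) \<Rightarrow> 'a \<Rightarrow> bool" where
  "scalar_identity n R g e \<longleftrightarrow> e \<in> R \<and> (\<forall>x\<in>R. g (x # replicate (n - 1) e) = x)"

text \<open>These equations alone do not force \<open>h\<close> to map zero to zero: the constant map \<open>1\<close> into the
  hyperfield of signs \<open>{-1, 0, 1}\<close>, where \<open>1 + 1 = {1}\<close>, satisfies them, and the preimage of the
  hyperideal \<open>{0}\<close> under it is empty. Preservation of zero is therefore a separate assumption
  where it is needed.\<close>

definition hyperring_hom ::
  "nat \<Rightarrow> nat \<Rightarrow> 'a set \<Rightarrow> ('a list \<Rightarrow> 'a set) \<Rightarrow> ('a list \<Rightarrow> 'a) \<Rightarrow>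
   'b set \<Rightarrow> ('b list \<Rightarrow> 'b set) \<Rightarrow> ('b list \<Rightarrow> 'b) \<Rightarrow> ('a \<Rightarrow> 'b) \<Rightarrow> bool" where
  "hyperring_hom m n R1 f1 g1 R2 f2 g2 h \<longleftrightarrow>
     h \<in> R1 \<rightarrow> R2 \<and>
     (\<forall>xs\<in>nlists m R1. h ` f1 xs = f2 (map h xs)) \<and>
     (\<forall>ys\<in>nlists n R1. h (g1 ys) = g2 (map h ys))"

definition hyperideal ::
  "nat \<Rightarrow> nat \<Rightarrow> 'a set \<Rightarrow> ('a list \<Rightarrow> 'a set) \<Rightarrow> ('a list \<Rightarrow> 'a) \<Rightarrow> 'a set \<Rightarrow> bool" where
  "hyperideal m n R f g I \<longleftrightarrow>
     I \<noteq> {} \<and> I \<subseteq> R \<and>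
     (\<forall>xs\<in>nlists m I. f xs \<subseteq> I) \<and>
     (\<forall>as bs. \<forall>b\<in>I. as @ bs \<in> nlists (m - 1) I \<longrightarrow> (\<exists>x\<in>I. b \<in> f (as @ x # bs))) \<and>
     (\<forall>as bs. \<forall>x\<in>I. as @ bs \<in> nlists (n - 1) R \<longrightarrow> g (as @ x # bs) \<in> I)"

definition multiplicative_subset :: "nat \<Rightarrow> 'a set \<Rightarrow> ('a list \<Rightarrow> 'a) \<Rightarrow> 'a set \<Rightarrow> bool" where
  "multiplicative_subset n R g S \<longleftrightarrow> S \<noteq> {} \<and> S \<subseteq> R \<and> (\<forall>xs\<in>nlists n S. g xs \<in> S)"

text \<open>The scalar identity \<open>e\<close> is a parameter because for \<open>n > 2\<close> it need not be unique: in a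
  commutative ring with \<open>g [x, y, z] = x * y * z\<close>, both \<open>1\<close> and \<open>-1\<close> are scalar identities.\<close>

definition S_prime_hyperideal ::
  "nat \<Rightarrow> nat \<Rightarrow> 'a set \<Rightarrow> ('a list \<Rightarrow> 'a set) \<Rightarrow> ('a list \<Rightarrow> 'a) \<Rightarrow> 'a \<Rightarrow> 'a set \<Rightarrow> 'a set \<Rightarrow> bool" where
  "S_prime_hyperideal m n R f g e S I \<longleftrightarrow>
     hyperideal m n R f g I \<and> I \<inter> S = {} \<and>
     (\<exists>s\<in>S. \<forall>xs\<in>nlists n R. g xs \<in> I \<longrightarrow>
        (\<exists>i<n. g (s # xs ! i # replicate (n - 2) e) \<in> I))"

end

theory Submission
  imports Defs
begin

text \<open>
  The preimage of a hyperideal is closed under solving equations because \<open>h\<close> commutes with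
  negation, so that by reversibility every solution of \<open>b \<in> f\<^sub>1(as, x, bs)\<close> in \<open>R\<^sub>1\<close> already lies in
  the preimage. As \<open>h\<close> need not send \<open>e\<^sub>1\<close> to \<open>e\<^sub>2\<close>, the witness \<open>g\<^sub>2(h s, h x, e\<^sub>2, \<dots>, e\<^sub>2) \<in> I\<^sub>2\<close> of
  primeness has to be converted: multiplying it by one \<open>e\<^sub>2\<close> and by \<open>n - 2\<close> copies of \<open>h e\<^sub>1\<close>, the
  \<open>n - 1\<close> factors \<open>e\<^sub>2\<close> are absorbed by \<open>h s\<close>, leaving \<open>h (g\<^sub>1(s, x, e\<^sub>1, \<dots>, e\<^sub>1)) \<in> I\<^sub>2\<close>.
\<close>

text \<open>These simplification rules loop together with \<open>nlists_def\<close>, and the elimination rule destroys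
  the premise \<open>as @ bs \<in> nlists k A\<close> of the closure conditions.\<close>

declare nlistsE_length [simp del] nlistsE_set [simp del] nlists_appendE [rule del]

lemma hyperideal_mult_closed:
  "hyperideal m n R f g I \<Longrightarrow> x \<in> I \<Longrightarrow> as @ bs \<in> nlists (n - 1) R \<Longrightarrow> g (as @ x # bs) \<in> I"
  unfolding hyperideal_def by blast

lemma hyperideal_solvable:
  "hyperideal m n R f g I \<Longrightarrow> as @ bs \<in> nlists (m - 1) I \<Longrightarrow> b \<in> I \<Longrightarrow> \<exists>x\<in>I. b \<in> f (as @ x # bs)"
  unfolding hyperideal_def by blast

context canonical_hypergroup
begin

lemma is_zero_hzero: "is_zero m R f (hzero m R f)"
  unfolding hzero_def by (rule theI') (rule zero_unique)

lemma hzero_closed: "hzero m R f \<in> R"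
  using is_zero_hzero by (simp add: is_zero_def)

lemma is_neg_hneg: "x \<in> R \<Longrightarrow> is_neg m R f x (hneg m R f x)"
  unfolding hneg_def by (rule theI') (rule neg_unique)

lemma hneg_closed: "x \<in> R \<Longrightarrow> hneg m R f x \<in> R"
  using is_neg_hneg by (simp add: is_neg_def)

lemma hneg_eqI: "x \<in> R \<Longrightarrow> is_neg m R f x y \<Longrightarrow> hneg m R f x = y"
  using neg_unique is_neg_hneg by blast

end

context comm_krasner_hyperring
begin

text \<open>By absorption, the product of any member of \<open>I\<close> with zeros lies in
  \<open>I\<close>, and this product is zero.\<close>

lemma hyperideal_hzero:
  assumes "hyperideal m n R f g I"
  shows "hzero m R f \<in> I"
proof -
  let ?z = "hzero m R f"
  obtain x where x: "x \<in> I" "x \<in> R"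
    using assms by (auto simp: hyperideal_def)
  define k where "k = n - 2"
  have n: "n = Suc (Suc k)" using mult_arity by (simp add: k_def)
  have z: "?z \<in> R" by (rule hzero_closed)
  have "g ([] @ x # ?z # replicate k ?z) \<in> I"
    using x z by (intro hyperideal_mult_closed[OF assms]) (auto simp: nlists_def n)
  moreover have "g (x # ?z # replicate k ?z) = g (?z # x # replicate k ?z)"
    using x z by (intro mult_perm) (auto simp: nlists_def n)
  moreover have "g (?z # x # replicate k ?z) = ?z"
    using x z by (intro mult_zero) (auto simp: nlists_def n)
  ultimately show ?thesis by simp
qed

text \<open>Solving \<open>0 \<in> f (y, x, 0, ..., 0)\<close> inside \<open>I\<close> gives a
  negative of \<open>y\<close> in \<open>I\<close>, which is \<open>hneg m R f y\<close> because
  negatives are unique.\<close>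

lemma hyperideal_hneg:
  assumes I: "hyperideal m n R f g I" and y: "y \<in> I"
  shows "hneg m R f y \<in> I"
proof -
  let ?z = "hzero m R f"
  have z: "?z \<in> I" using I by (rule hyperideal_hzero)
  have "[y] @ replicate (m - 2) ?z \<in> nlists (m - 1) I"
    using y z arity by (auto simp: nlists_def)
  then obtain x where x: "x \<in> I" "?z \<in> f ([y] @ x # replicate (m - 2) ?z)"
    using hyperideal_solvable[OF I] z by blast
  moreover have "y \<in> R" "x \<in> R" using I y x by (auto simp: hyperideal_def)
  ultimately have "hneg m R f y = x"
    by (intro hneg_eqI) (auto simp: is_neg_def)
  with x show ?thesis by simp
qed

lemma hyperideal_change_padding:
  assumes I: "hyperideal m n R f g I" and e: "scalar_identity n R g e"
    and R: "s \<in> R" "x \<in> R" "w \<in> R"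
    and sx: "g (s # x # replicate (n - 2) e) \<in> I"
  shows "g (s # x # replicate (n - 2) w) \<in> I"
proof -
  define k where "k = n - 2"
  have n: "n = Suc (Suc k)" using mult_arity by (simp add: k_def)
  have eR: "e \<in> R" using e by (simp add: scalar_identity_def)
  \<comment> \<open>With \<open>x\<close> in front, moving the inner product one place to the right
    drops \<open>x\<close> and keeps \<open>s\<close>, now followed by \<open>k + 1 = n - 1\<close>
    copies of \<open>e\<close>.\<close>
  have "g (x # s # replicate k e) = g (s # x # replicate k e)"
    using R eR by (intro mult_perm) (auto simp: nlists_def n)
  then have "g (x # s # replicate k e) \<in> I" using sx by (simp add: k_def)
  then have "g ([] @ g (x # s # replicate k e) # e # replicate k w) \<in> I"
    using R eR by (intro hyperideal_mult_closed[OF I]) (auto simp: nlists_def n)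
  also have "g ([] @ g (x # s # replicate k e) # e # replicate k w)
      = g (x # g (s # e # replicate k e) # replicate k w)"
  proof -
    \<comment> \<open>The inner product starts at position 0 on the left-hand side and at position 1
      on the right-hand side; the length is \<open>2 * k + 3 = 2 * n - 1\<close>, as associativity
      requires.\<close>
    let ?xs = "x # s # replicate k e @ e # replicate k w"
    have shift: "?xs = x # s # e # replicate k e @ replicate k w"
      by (simp add: replicate_app_Cons_same)
    have 0: "take n ?xs = x # s # replicate k e" "drop n ?xs = e # replicate k w"
      by (simp_all add: n)
    have 1: "take n (drop 1 ?xs) = s # e # replicate k e" "drop (1 + n) ?xs = replicate k w"
      unfolding shift by (simp_all add: n)
    have "?xs \<in> nlists (2 * n - 1) R"
      using R eR by (auto simp: nlists_def n)
    then have "g (take 0 ?xs @ g (take n (drop 0 ?xs)) # drop (0 + n) ?xs)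
        = g (take 1 ?xs @ g (take n (drop 1 ?xs)) # drop (1 + n) ?xs)"
      by (rule mult_assoc) (simp_all add: n)
    then show ?thesis unfolding 1 drop_0 add_0 0 by simp
  qed
  also have "g (s # e # replicate k e) = s"
    using e R by (simp add: scalar_identity_def n)
  also have "g (x # s # replicate k w) = g (s # x # replicate k w)"
    using R by (intro mult_perm) (auto simp: nlists_def n)
  finally show ?thesis by (simp add: k_def)
qed

end

text \<open>Applying \<open>h\<close> to \<open>0 \<in> f1 (x, -x, 0, ..., 0)\<close> and using
  \<open>h0\<close> shows that the image of \<open>-x\<close> is a negative of \<open>h x\<close>;
  negatives in \<open>R2\<close> are unique.\<close>

lemma hyperring_hom_hneg:
  assumes "canonical_hypergroup m R1 f1" and "canonical_hypergroup m R2 f2"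
    and h: "hyperring_hom m n R1 f1 g1 R2 f2 g2 h"
    and h0: "h (hzero m R1 f1) = hzero m R2 f2"
    and x: "x \<in> R1"
  shows "h (hneg m R1 f1 x) = hneg m R2 f2 (h x)"
proof -
  interpret A: canonical_hypergroup m R1 f1 by fact
  interpret B: canonical_hypergroup m R2 f2 by fact
  let ?xs = "x # hneg m R1 f1 x # replicate (m - 2) (hzero m R1 f1)"
  have hR: "h \<in> R1 \<rightarrow> R2" using h by (simp add: hyperring_hom_def)
  have "?xs \<in> nlists m R1"
    using x A.hneg_closed[OF x] A.hzero_closed A.arity by (auto simp: nlists_def)
  then have "h ` f1 ?xs = f2 (map h ?xs)" using h by (simp add: hyperring_hom_def)
  moreover have "hzero m R1 f1 \<in> f1 ?xs"
    using A.is_neg_hneg[OF x] by (simp add: is_neg_def)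
  ultimately have "hzero m R2 f2 \<in> f2 (map h ?xs)" by (metis h0 imageI)
  then have "is_neg m R2 f2 (h x) (h (hneg m R1 f1 x))"
    using A.hneg_closed[OF x] hR h0 by (auto simp: is_neg_def)
  then show ?thesis using B.hneg_eqI x hR by (metis PiE)
qed

lemma hyperideal_vimage:
  assumes "comm_krasner_hyperring m n R1 f1 g1" and "comm_krasner_hyperring m n R2 f2 g2"
    and h: "hyperring_hom m n R1 f1 g1 R2 f2 g2 h"
    and h0: "h (hzero m R1 f1) = hzero m R2 f2"
    and I: "hyperideal m n R2 f2 g2 I"
  shows "hyperideal m n R1 f1 g1 (h -` I \<inter> R1)"
proof -
  interpret A: comm_krasner_hyperring m n R1 f1 g1 by fact
  interpret B: comm_krasner_hyperring m n R2 f2 g2 by fact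
  let ?J = "h -` I \<inter> R1"
  have hR: "\<And>x. x \<in> R1 \<Longrightarrow> h x \<in> R2"
    and hf: "\<And>xs. xs \<in> nlists m R1 \<Longrightarrow> h ` f1 xs = f2 (map h xs)"
    and hg: "\<And>xs. xs \<in> nlists n R1 \<Longrightarrow> h (g1 xs) = g2 (map h xs)"
    using h by (auto simp: hyperring_hom_def)
  have If: "\<And>xs. xs \<in> nlists m I \<Longrightarrow> f2 xs \<subseteq> I"
    using I by (auto simp: hyperideal_def)
  have neg: "hneg m R1 f1 x \<in> ?J" if "x \<in> ?J" for x
    using that A.hneg_closed B.hyperideal_hneg[OF I]
      hyperring_hom_hneg[OF A.canonical_hypergroup_axioms B.canonical_hypergroup_axioms h h0]
    by auto
  \<comment> \<open>Besides being one of the hyperideal conditions, this closure serves to place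
    solutions of equations in \<open>?J\<close>.\<close>
  have f_closed: "f1 xs \<subseteq> ?J" if xs: "xs \<in> nlists m ?J" for xs
  proof -
    have 1: "xs \<in> nlists m R1" and "map h xs \<in> nlists m I"
      using xs by (auto simp: nlists_def)
    then have "h ` f1 xs \<subseteq> I" using hf If by simp
    with A.closed[OF 1] show ?thesis by auto
  qed
  show ?thesis
    unfolding hyperideal_def
  proof (intro conjI ballI allI impI)
    \<comment> \<open>Zero is a member, since \<open>h0\<close> sends it to the zero of
      \<open>R2\<close>, which lies in \<open>I\<close>.\<close>
    show "?J \<noteq> {}"
      using A.hzero_closed h0 B.hyperideal_hzero[OF I] by auto
    show "?J \<subseteq> R1" by simp
    show "f1 xs \<subseteq> ?J" if "xs \<in> nlists m ?J" for xs
      using that by (rule f_closed)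
    show "\<exists>x\<in>?J. b \<in> f1 (as @ x # bs)"
      if b: "b \<in> ?J" and ab: "as @ bs \<in> nlists (m - 1) ?J" for as bs b
    proof -
      have "as @ bs \<in> nlists (m - 1) R1" using ab by (auto simp: nlists_def)
      then obtain x where x: "x \<in> R1" "b \<in> f1 (as @ x # bs)"
        using A.solvable b by blast
      have "as @ x # bs \<in> nlists m R1"
        using ab x A.arity by (auto simp: nlists_def)
      \<comment> \<open>Position \<open>length as\<close> is that of \<open>x\<close>, so
        reversibility puts \<open>x\<close> into a hypersum of \<open>b\<close> and negatives of
        members of \<open>?J\<close>.\<close>
      from A.reversible[OF this x(2), of "length as"]
      have "x \<in> f1 (b # map (hneg m R1 f1) as @ map (hneg m R1 f1) bs)"
        using ab A.arity by (auto simp: nlists_def)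
      moreover have "b # map (hneg m R1 f1) as @ map (hneg m R1 f1) bs \<in> nlists m ?J"
      proof -
        have "set as \<subseteq> ?J" "set bs \<subseteq> ?J" and len: "length as + length bs = m - 1"
          using ab by (auto simp: nlists_def)
        then have "hneg m R1 f1 ` set as \<subseteq> ?J" "hneg m R1 f1 ` set bs \<subseteq> ?J"
          using neg by blast+
        with b len A.arity show ?thesis by (simp add: nlists_def)
      qed
      ultimately have "x \<in> ?J" using f_closed by blast
      with x show ?thesis by blast
    qed
    show "g1 (as @ x # bs) \<in> ?J"
      if x: "x \<in> ?J" and ab: "as @ bs \<in> nlists (n - 1) R1" for as bs x
    proof -
      have 1: "as @ x # bs \<in> nlists n R1"
        using ab x A.mult_arity by (auto simp: nlists_def)
      have "map h as @ map h bs \<in> nlists (n - 1) R2"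
        using ab hR by (auto simp: nlists_def)
      then have "h (g1 (as @ x # bs)) \<in> I" using hyperideal_mult_closed[OF I] hg[OF 1] x by simp
      with A.mult_closed[OF 1] show ?thesis by simp
    qed
  qed
qed

theorem theorem3p11:
  fixes m n :: nat
    and R1 :: "'a set" and f1 :: "'a list \<Rightarrow> 'a set" and g1 :: "'a list \<Rightarrow> 'a" and e1 :: 'a
    and R2 :: "'b set" and f2 :: "'b list \<Rightarrow> 'b set" and g2 :: "'b list \<Rightarrow> 'b" and e2 :: 'b
    and S :: "'a set" and h :: "'a \<Rightarrow> 'b" and I2 :: "'b set"
  assumes "comm_krasner_hyperring m n R1 f1 g1" and "scalar_identity n R1 g1 e1"
    and "comm_krasner_hyperring m n R2 f2 g2" and "scalar_identity n R2 g2 e2"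
    and "multiplicative_subset n R1 g1 S"
    and "hyperring_hom m n R1 f1 g1 R2 f2 g2 h"
    and "h (hzero m R1 f1) = hzero m R2 f2"
    and "hzero m R2 f2 \<notin> h ` S"
    and "S_prime_hyperideal m n R2 f2 g2 e2 (h ` S) I2"
  shows "S_prime_hyperideal m n R1 f1 g1 e1 S (h -` I2 \<inter> R1)"
proof -
  interpret A: comm_krasner_hyperring m n R1 f1 g1 by fact
  interpret B: comm_krasner_hyperring m n R2 f2 g2 by fact
  let ?J = "h -` I2 \<inter> R1"
  note e2 = assms(4)
  have hR: "\<And>x. x \<in> R1 \<Longrightarrow> h x \<in> R2"
    and hg: "\<And>xs. xs \<in> nlists n R1 \<Longrightarrow> h (g1 xs) = g2 (map h xs)"
    using assms(6) by (auto simp: hyperring_hom_def)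
  have e1: "e1 \<in> R1" using assms(2) by (simp add: scalar_identity_def)
  have I: "hyperideal m n R2 f2 g2 I2" and disj: "I2 \<inter> h ` S = {}"
    using assms(9) by (auto simp: S_prime_hyperideal_def)
  \<comment> \<open>The witness of primeness for \<open>I2\<close> lies in the image of
    \<open>S\<close>; a preimage \<open>s \<in> S\<close> of it is the witness for
    \<open>?J\<close>.\<close>
  obtain s where s: "s \<in> S" and prime: "\<And>ys. ys \<in> nlists n R2 \<Longrightarrow> g2 ys \<in> I2 \<Longrightarrow>
      \<exists>i<n. g2 (h s # ys ! i # replicate (n - 2) e2) \<in> I2"
    using assms(9) by (auto simp: S_prime_hyperideal_def)
  have sR: "s \<in> R1" using s assms(5) by (auto simp: multiplicative_subset_def)
  have "\<exists>i<n. g1 (s # xs ! i # replicate (n - 2) e1) \<in> ?J"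
    if xs: "xs \<in> nlists n R1" and gJ: "g1 xs \<in> ?J" for xs
  proof -
    have "map h xs \<in> nlists n R2" using xs hR by (auto simp: nlists_def)
    moreover have "g2 (map h xs) \<in> I2" using gJ hg[OF xs] by simp
    ultimately obtain i where i: "i < n"
      and "g2 (h s # map h xs ! i # replicate (n - 2) e2) \<in> I2"
      using prime by blast
    then have 1: "g2 (h s # h (xs ! i) # replicate (n - 2) e2) \<in> I2"
      using xs by (simp add: nlists_def)
    have xi: "xs ! i \<in> R1" using xs i by (auto simp: nlists_def)
    have 2: "s # xs ! i # replicate (n - 2) e1 \<in> nlists n R1"
      using sR xi e1 A.mult_arity by (auto simp: nlists_def)
    \<comment> \<open>Only with padding \<open>h e1\<close> is this product the image under
      \<open>h\<close> of a product in \<open>R1\<close>.\<close>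
    have "g2 (h s # h (xs ! i) # replicate (n - 2) (h e1)) \<in> I2"
      using B.hyperideal_change_padding[OF I e2 hR[OF sR] hR[OF xi] hR[OF e1] 1] .
    then have "h (g1 (s # xs ! i # replicate (n - 2) e1)) \<in> I2"
      using hg[OF 2] by simp
    with A.mult_closed[OF 2] i show ?thesis by blast
  qed
  moreover have "hyperideal m n R1 f1 g1 ?J"
    using assms(1,3,6,7) I by (rule hyperideal_vimage)
  moreover have "?J \<inter> S = {}" using disj by auto
  ultimately show ?thesis
    using s unfolding S_prime_hyperideal_def by blast
qed

end
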